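(* Let $\{\tau_k\}\downarrow0$ and, for each $k$, let $v^k$ be a stationary point of the relaxed problem (NLP-$\tau_k$), with $v^k\to v$, where $v$ is a feasible point of problem (P). Then $v$ is a C-stationary point of (P).
   Context: **Problem (P).** Let $K,m_1,m_2,n$ be positive integers, $[N]:=\{1,\dots,N\}$, and let $\mathbf 1$ denote an all-ones vector. In $K$-fold cross-validation a data set of labelled points $(x,y)$, $x\in\mathbb{R}^n$, $y\in\{\pm1\}$, is partitioned into $K$ disjoint validation sets of size $m_1$; the training set of fold $t$ is the complement of the $t$-th validation set and has size $m_2$. (Each $x$ already includes an additional component equal to 1 that absorbs the bias term.) Let $B^t\in\mathbb{R}^{m_2\times n}$ be the matrix whose rows are $y\,x^\top$ over the training points of fold $t$, and $A^t\in\mathbb{R}^{m_1\times n}$ the matrix whose rows are $y\,x^\top$ over the validation points of fold $t$. Let $B=\mathrm{diag}(B^1,\dots,B^K)$ and $A=\mathrm{diag}(A^1,\dots,A^K)$ (block diagonal), and let $E_K^n\in\mathbb{R}^{Kn\times n}$ be $K$ copies of $I_n$ stacked vertically. Let $C_{lb},C_{ub}\in\mathbb{R}_+$, $\overline w_{lb},\overline w_{ub}\in\mathbb{R}^n_+$ be given bounds. Put $\overline n=1+n$, $\overline m=2K(m_1+m_2+n)$. The variable is $v=[C,\overline w^\top,\zeta^\top,z^\top,\alpha^\top,\xi^\top,\beta^\top,\gamma^\top]^\top\in\mathbb{R}^{\overline n+\overline m}$ with $C\in\mathbb{R}$, $\overline w\in\mathbb{R}^n$, $\zeta,z\in\mathbb{R}^{Km_1}$,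 $\alpha,\xi\in\mathbb{R}^{Km_2}$, $\beta,\gamma\in\mathbb{R}^{Kn}$, each of the last six being the stack of $K$ blocks $\zeta^t$, $\alpha^t$, etc. Problem (P) is $$\min_v f(v)\quad\text{s.t.}\quad g(v)\ge\mathbf 0,\quad \mathbf 0\le H(v)\perp G(v)\ge\mathbf 0,$$ with $f(v)=\frac1{Km_1}\mathbf 1^\top\zeta$, $g(v)=(C_{ub}-C,\ C-C_{lb},\ \overline w_{ub}-\overline w,\ \overline w-\overline w_{lb})\in\mathbb{R}^{2\overline n}$, $H(v)=(\zeta,z,\alpha,\xi,\beta,\gamma)\in\mathbb{R}^{\overline m}$, and $$G(v)=\begin{pmatrix}AB^\top\alpha+A\beta-A\gamma+z\\ \mathbf 1-\zeta\\ BB^\top\alpha+B\beta-B\gamma-\mathbf 1+\xi\\ \mathbf 1C-\alpha\\ B^\top\alpha+\beta-\gamma+E_K^n\overline w\\ -B^\top\alpha-\beta+\gamma+E_K^n\overline w\end{pmatrix}\in\mathbb{R}^{\overline m}.$$ **Standing assumptions.** (i) No validation point lies on the decision boundary: for each $t$ and each validation point $x$ of fold $t$, $x^\top w^t\ne0$, where $w^t=(B^t)^\top\alpha^t+\beta^t-\gamma^t$. (ii) For each fold $t$ there is at least one training point with label $1$ that is not a support vector and at least one with label $-1$ that is not a support vector. (iii) For each fold $t$ there are at least two training points with label $1$ that are support vectors and at least two with label $-1$ that are support vectors. (A support vector of fold $t$ is a training point whose multiplier, the corresponding component of $\alpha^t$, is positive.) **Relaxed problem.** For $\tau>0$, (NLP-$\tau$)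 is $\min f(v)$ s.t. $g(v)\ge\mathbf 0$, $G(v)\ge\mathbf 0$, $H(v)\ge\mathbf 0$, $G_i(v)H_i(v)\le\tau$ for $i\in[\overline m]$. A stationary point is a feasible $v$ satisfying the KKT conditions, i.e. for which there exist multipliers $\lambda^g\in\mathbb{R}^{2\overline n}$, $\lambda^G,\lambda^H,\lambda^{GH}\in\mathbb{R}^{\overline m}$, all $\ge\mathbf 0$, with $$\nabla f(v)-\sum_i\lambda^g_i\nabla g_i(v)-\sum_i\lambda^G_i\nabla G_i(v)-\sum_i\lambda^H_i\nabla H_i(v)+\sum_i\lambda^{GH}_i\big(H_i(v)\nabla G_i(v)+G_i(v)\nabla H_i(v)\big)=\mathbf 0$$ and $\lambda^g_ig_i(v)=0$, $\lambda^G_iG_i(v)=0$, $\lambda^H_iH_i(v)=0$, $\lambda^{GH}_i(\tau-G_i(v)H_i(v))=0$ for all $i$. **Index sets.** For $v$ feasible for (P): $I_G=\{i\in[\overline m]:G_i(v)=0,H_i(v)>0\}$, $I_{GH}=\{i\in[\overline m]:G_i(v)=0,H_i(v)=0\}$, $I_H=\{i\in[\overline m]:G_i(v)>0,H_i(v)=0\}$. **C-stationarity.** A feasible $v$ of (P) is C-stationary if there are $\gamma,\nu\in\mathbb{R}^{\overline m}$ and $\lambda\in\mathbb{R}^{2\overline n}$ with $$\nabla f(v)-\sum_{i=1}^{\overline m}\gamma_i\nabla G_i(v)-\sum_{i=1}^{\overline m}\nu_i\nabla H_i(v)-\sum_{i=1}^{2\overline n}\lambda_i\nabla g_i(v)=\mathbf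 0,$$ $\lambda_i\ge0$ and $\lambda_ig_i(v)=0$ for all $i$, $\gamma_i=0$ for $i\in I_H$, $\nu_i=0$ for $i\in I_G$, and $\gamma_i\nu_i\ge0$ for $i\in I_{GH}$. (In this definition $\gamma$ denotes a multiplier, not the $\gamma$-block of the variable.) *)

theory Defs
  imports "HOL-Analysis.Analysis"
begin

section \<open>Mathematical programs with complementarity constraints\<close>

definition grad :: "('a::real_inner \<Rightarrow> real) \<Rightarrow> 'a \<Rightarrow> 'a"
  where "grad F v = (THE D. GDERIV F v :> D)"

lemma grad_eqI:
  assumes "GDERIV F v :> D"
  shows "grad F v = D"
  unfolding grad_def
proof (rule the_equality)
  show "GDERIV F v :> D" by fact
next
  fix D' assume "GDERIV F v :> D'"
  then have "(\<lambda>h. h \<bullet> D') = (\<lambda>h. h \<bullet> D)"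
    using assms unfolding gderiv_def by (rule has_derivative_unique)
  then have "(D' - D) \<bullet> D' = (D' - D) \<bullet> D"
    by (rule fun_cong)
  then show "D' = D" by (metis eq_iff_diff_eq_0 inner_diff_right inner_eq_zero_iff)
qed

definition mpcc_feasible ::
  "('v \<Rightarrow> real^'p) \<Rightarrow> ('v \<Rightarrow> real^'q) \<Rightarrow> ('v \<Rightarrow> real^'q) \<Rightarrow> 'v \<Rightarrow> bool"
  where "mpcc_feasible g G H v \<longleftrightarrow>
    0 \<le> g v \<and> 0 \<le> H v \<and> orthogonal (H v) (G v) \<and> 0 \<le> G v"

definition I_G :: "('v \<Rightarrow> real^'q) \<Rightarrow> ('v \<Rightarrow> real^'q) \<Rightarrow> 'v \<Rightarrow> 'q set"
  where "I_G G H v = {i. G v $ i = 0 \<and> H v $ i > 0}"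

definition I_GH :: "('v \<Rightarrow> real^'q) \<Rightarrow> ('v \<Rightarrow> real^'q) \<Rightarrow> 'v \<Rightarrow> 'q set"
  where "I_GH G H v = {i. G v $ i = 0 \<and> H v $ i = 0}"

definition I_H :: "('v \<Rightarrow> real^'q) \<Rightarrow> ('v \<Rightarrow> real^'q) \<Rightarrow> 'v \<Rightarrow> 'q set"
  where "I_H G H v = {i. G v $ i > 0 \<and> H v $ i = 0}"

definition C_stationary ::
  "('v::real_inner \<Rightarrow> real) \<Rightarrow> ('v \<Rightarrow> real^'p) \<Rightarrow> ('v \<Rightarrow> real^'q) \<Rightarrow> ('v \<Rightarrow> real^'q) \<Rightarrow> 'v \<Rightarrow> bool"
  where "C_stationary f g G H v \<longleftrightarrow> mpcc_feasible g G H v \<and>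
    (\<exists>(\<gamma> :: real^'q) (\<nu> :: real^'q) (lam :: real^'p).
      grad f v
        - (\<Sum>i\<in>UNIV. \<gamma> $ i *\<^sub>R grad (\<lambda>u. G u $ i) v)
        - (\<Sum>i\<in>UNIV. \<nu> $ i *\<^sub>R grad (\<lambda>u. H u $ i) v)
        - (\<Sum>i\<in>UNIV. lam $ i *\<^sub>R grad (\<lambda>u. g u $ i) v) = 0 \<and>
      (\<forall>i. lam $ i \<ge> 0 \<and> lam $ i * g v $ i = 0) \<and>
      (\<forall>i\<in>I_H G H v. \<gamma> $ i = 0) \<and>
      (\<forall>i\<in>I_G G H v. \<nu> $ i = 0) \<and>
      (\<forall>i\<in>I_GH G H v. \<gamma> $ i * \<nu> $ i \<ge> 0))"

definition relaxed_feasible ::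
  "('v \<Rightarrow> real^'p) \<Rightarrow> ('v \<Rightarrow> real^'q) \<Rightarrow> ('v \<Rightarrow> real^'q) \<Rightarrow> real \<Rightarrow> 'v \<Rightarrow> bool"
  where "relaxed_feasible g G H \<tau> v \<longleftrightarrow>
    0 \<le> g v \<and> 0 \<le> G v \<and> 0 \<le> H v \<and> (\<forall>i. G v $ i * H v $ i \<le> \<tau>)"

definition relaxed_stationary ::
  "('v::real_inner \<Rightarrow> real) \<Rightarrow> ('v \<Rightarrow> real^'p) \<Rightarrow> ('v \<Rightarrow> real^'q) \<Rightarrow> ('v \<Rightarrow> real^'q) \<Rightarrow> real \<Rightarrow> 'v \<Rightarrow> bool"
  where "relaxed_stationary f g G H \<tau> v \<longleftrightarrow> relaxed_feasible g G H \<tau> v \<and>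
    (\<exists>(lam_g :: real^'p) (lam_G :: real^'q) (lam_H :: real^'q) (lam_GH :: real^'q).
      0 \<le> lam_g \<and> 0 \<le> lam_G \<and> 0 \<le> lam_H \<and> 0 \<le> lam_GH \<and>
      grad f v
        - (\<Sum>i\<in>UNIV. lam_g $ i *\<^sub>R grad (\<lambda>u. g u $ i) v)
        - (\<Sum>i\<in>UNIV. lam_G $ i *\<^sub>R grad (\<lambda>u. G u $ i) v)
        - (\<Sum>i\<in>UNIV. lam_H $ i *\<^sub>R grad (\<lambda>u. H u $ i) v)
        + (\<Sum>i\<in>UNIV. lam_GH $ i *\<^sub>R
             (H v $ i *\<^sub>R grad (\<lambda>u. G u $ i) v + G v $ i *\<^sub>R grad (\<lambda>u. H u $ i) v)) = 0 \<and>
      (\<forall>i. lam_g $ i * g v $ i = 0) \<and>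
      (\<forall>i. lam_G $ i * G v $ i = 0) \<and>
      (\<forall>i. lam_H $ i * H v $ i = 0) \<and>
      (\<forall>i. lam_GH $ i * (\<tau> - G v $ i * H v $ i) = 0))"


section \<open>Cross-validation data\<close>

text \<open>The types \<open>'k\<close>, \<open>'a\<close>, \<open>'b\<close>, \<open>'n\<close> index the folds, the validation points of a fold, the training
  points of a fold, and the features; \<open>K\<close>, \<open>m\<^sub>1\<close>, \<open>m\<^sub>2\<close>, \<open>n\<close> are their cardinalities. The data points are
  indexed by \<open>'d\<close>; \<open>val t\<close> and \<open>trn t\<close> enumerate the validation and the training set of fold \<open>t\<close>.
  Bijectivity of the uncurried \<open>val\<close> says that the validation sets partition the data set.\<close>

definition cv_data ::
  "('d \<Rightarrow> real^'n) \<Rightarrow> ('d \<Rightarrow> real) \<Rightarrow> ('k::finite \<Rightarrow> 'a::finite \<Rightarrow> 'd) \<Rightarrow> ('k \<Rightarrow> 'b::finite \<Rightarrow> 'd) \<Rightarrow> bool"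
  where "cv_data x y val trn \<longleftrightarrow>
    (\<forall>d. y d \<in> {1, -1}) \<and>
    (\<exists>j. \<forall>d. x d $ j = 1) \<and>
    bij (\<lambda>(t, i). val t i) \<and>
    (\<forall>t. bij_betw (trn t) UNIV (- range (val t)))"

definition label_matrix ::
  "('d \<Rightarrow> real^'n) \<Rightarrow> ('d \<Rightarrow> real) \<Rightarrow> ('k \<Rightarrow> 'm \<Rightarrow> 'd) \<Rightarrow> 'k \<Rightarrow> real^'n^'m"
  where "label_matrix x y pts t = (\<chi> i. y (pts t i) *\<^sub>R x (pts t i))"

definition block_diag :: "('k::finite \<Rightarrow> real^'n^'m) \<Rightarrow> real^('k \<times> 'n)^('k \<times> 'm)"
  where "block_diag M = (\<chi> r c. if fst r = fst c then M (fst r) $ snd r $ snd c else 0)"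

definition stack_id :: "real^'n^('k::finite \<times> 'n)"
  where "stack_id = (\<chi> r c. if snd r = c then 1 else 0)"

definition block :: "'k \<Rightarrow> real^('k::finite \<times> 'm::finite) \<Rightarrow> real^'m"
  where "block t u = (\<chi> i. u $ (t, i))"


section \<open>The cross-validation problem\<close>

text \<open>Complementarity pairs (named after their \<open>H\<close>-component), coordinates of \<open>v\<close>, and components of
  \<open>g\<close>.\<close>

datatype ('k, 'a, 'b, 'n) pair_idx =
    PZeta "'k \<times> 'a" | PZ "'k \<times> 'a" | PAlpha "'k \<times> 'b" | PXi "'k \<times> 'b" | PBeta "'k \<times> 'n" | PGamma "'k \<times> 'n"

datatype ('k, 'a, 'b, 'n) var_idx = VC | VW 'n | VPair "('k, 'a, 'b, 'n) pair_idx"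

datatype 'n bnd_idx = C_upper | C_lower | W_upper 'n | W_lower 'n

instance pair_idx :: (finite, finite, finite, finite) finite
proof
  have "(UNIV :: ('a, 'b, 'c, 'd) pair_idx set) =
    range PZeta \<union> range PZ \<union> range PAlpha \<union> range PXi \<union> range PBeta \<union> range PGamma"
    (is "_ = ?R")
  proof -
    have "i \<in> ?R" for i :: "('a, 'b, 'c, 'd) pair_idx"
      by (cases i) auto
    then show ?thesis by blast
  qed
  moreover have "finite ?R"
    by simp
  ultimately show "finite (UNIV :: ('a, 'b, 'c, 'd) pair_idx set)"
    by (rule ssubst)
qed

instance var_idx :: (finite, finite, finite, finite) finite
proof
  have "(UNIV :: ('a, 'b, 'c, 'd) var_idx set) = {VC} \<union> range VW \<union> range VPair" (is "_ = ?R")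
  proof -
    have "i \<in> ?R" for i :: "('a, 'b, 'c, 'd) var_idx"
      by (cases i) auto
    then show ?thesis by blast
  qed
  moreover have "finite ?R"
    by simp
  ultimately show "finite (UNIV :: ('a, 'b, 'c, 'd) var_idx set)"
    by (rule ssubst)
qed

instance bnd_idx :: (finite) finite
proof
  have "(UNIV :: 'a bnd_idx set) = {C_upper, C_lower} \<union> range W_upper \<union> range W_lower" (is "_ = ?R")
  proof -
    have "i \<in> ?R" for i :: "'a bnd_idx"
      by (cases i) auto
    then show ?thesis by blast
  qed
  moreover have "finite ?R"
    by simp
  ultimately show "finite (UNIV :: 'a bnd_idx set)"
    by (rule ssubst)
qed

type_synonym ('k, 'a, 'b, 'n) cv_var = "real^('k, 'a, 'b, 'n) var_idx"

definition C_of :: "('k::finite, 'a::finite, 'b::finite, 'n::finite) cv_var \<Rightarrow> real"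
  where "C_of v = v $ VC"

definition wbar_of :: "('k::finite, 'a::finite, 'b::finite, 'n::finite) cv_var \<Rightarrow> real^'n"
  where "wbar_of v = (\<chi> j. v $ VW j)"

definition zeta_of :: "('k::finite, 'a::finite, 'b::finite, 'n::finite) cv_var \<Rightarrow> real^('k \<times> 'a)"
  where "zeta_of v = (\<chi> p. v $ VPair (PZeta p))"

definition z_of :: "('k::finite, 'a::finite, 'b::finite, 'n::finite) cv_var \<Rightarrow> real^('k \<times> 'a)"
  where "z_of v = (\<chi> p. v $ VPair (PZ p))"

definition alpha_of :: "('k::finite, 'a::finite, 'b::finite, 'n::finite) cv_var \<Rightarrow> real^('k \<times> 'b)"
  where "alpha_of v = (\<chi> p. v $ VPair (PAlpha p))"

definition xi_of :: "('k::finite, 'a::finite, 'b::finite, 'n::finite) cv_var \<Rightarrow> real^('k \<times> 'b)"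
  where "xi_of v = (\<chi> p. v $ VPair (PXi p))"

definition beta_of :: "('k::finite, 'a::finite, 'b::finite, 'n::finite) cv_var \<Rightarrow> real^('k \<times> 'n)"
  where "beta_of v = (\<chi> p. v $ VPair (PBeta p))"

definition gamma_of :: "('k::finite, 'a::finite, 'b::finite, 'n::finite) cv_var \<Rightarrow> real^('k \<times> 'n)"
  where "gamma_of v = (\<chi> p. v $ VPair (PGamma p))"

definition cv_f :: "('k::finite, 'a::finite, 'b::finite, 'n::finite) cv_var \<Rightarrow> real"
  where "cv_f v = 1 / (real CARD('k) * real CARD('a)) * (1 \<bullet> zeta_of v)"

definition cv_g :: "real \<Rightarrow> real \<Rightarrow> real^'n \<Rightarrow> real^'n \<Rightarrow>
    ('k::finite, 'a::finite, 'b::finite, 'n::finite) cv_var \<Rightarrow> real^'n bnd_idx"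
  where "cv_g C_lb C_ub w_lb w_ub v = (\<chi> i. case i of
      C_upper \<Rightarrow> C_ub - C_of v
    | C_lower \<Rightarrow> C_of v - C_lb
    | W_upper j \<Rightarrow> (w_ub - wbar_of v) $ j
    | W_lower j \<Rightarrow> (wbar_of v - w_lb) $ j)"

definition cv_H :: "('k::finite, 'a::finite, 'b::finite, 'n::finite) cv_var \<Rightarrow>
    real^('k, 'a, 'b, 'n) pair_idx"
  where "cv_H v = (\<chi> i. case i of
      PZeta p \<Rightarrow> zeta_of v $ p
    | PZ p \<Rightarrow> z_of v $ p
    | PAlpha p \<Rightarrow> alpha_of v $ p
    | PXi p \<Rightarrow> xi_of v $ p
    | PBeta p \<Rightarrow> beta_of v $ p
    | PGamma p \<Rightarrow> gamma_of v $ p)"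

definition cv_G :: "real^('k \<times> 'n)^('k \<times> 'a) \<Rightarrow> real^('k \<times> 'n)^('k \<times> 'b) \<Rightarrow>
    ('k::finite, 'a::finite, 'b::finite, 'n::finite) cv_var \<Rightarrow> real^('k, 'a, 'b, 'n) pair_idx"
  where "cv_G A B v = (\<chi> i. case i of
      PZeta p \<Rightarrow> ((A ** transpose B) *v alpha_of v + A *v beta_of v - A *v gamma_of v + z_of v) $ p
    | PZ p \<Rightarrow> (1 - zeta_of v) $ p
    | PAlpha p \<Rightarrow>
        ((B ** transpose B) *v alpha_of v + B *v beta_of v - B *v gamma_of v - 1 + xi_of v) $ p
    | PXi p \<Rightarrow> (vec (C_of v) - alpha_of v) $ p
    | PBeta p \<Rightarrow>
        (transpose B *v alpha_of v + beta_of v - gamma_of v + stack_id *v wbar_of v) $ p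
    | PGamma p \<Rightarrow>
        (- (transpose B *v alpha_of v) - beta_of v + gamma_of v + stack_id *v wbar_of v) $ p)"

definition cv_w :: "('d \<Rightarrow> real^'n) \<Rightarrow> ('d \<Rightarrow> real) \<Rightarrow> ('k \<Rightarrow> 'b \<Rightarrow> 'd) \<Rightarrow>
    ('k::finite, 'a::finite, 'b::finite, 'n::finite) cv_var \<Rightarrow> 'k \<Rightarrow> real^'n"
  where "cv_w x y trn v t =
    transpose (label_matrix x y trn t) *v block t (alpha_of v) + block t (beta_of v) - block t (gamma_of v)"

definition support_vector ::
  "('k::finite, 'a::finite, 'b::finite, 'n::finite) cv_var \<Rightarrow> 'k \<Rightarrow> 'b \<Rightarrow> bool"
  where "support_vector v t i \<longleftrightarrow> block t (alpha_of v) $ i > 0"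

definition standing_assumptions ::
  "('d \<Rightarrow> real^'n) \<Rightarrow> ('d \<Rightarrow> real) \<Rightarrow> ('k \<Rightarrow> 'a \<Rightarrow> 'd) \<Rightarrow> ('k \<Rightarrow> 'b \<Rightarrow> 'd) \<Rightarrow>
    ('k::finite, 'a::finite, 'b::finite, 'n::finite) cv_var \<Rightarrow> bool"
  where "standing_assumptions x y val trn v \<longleftrightarrow>
    (\<forall>t i. x (val t i) \<bullet> cv_w x y trn v t \<noteq> 0) \<and>
    (\<forall>t. (\<exists>i. y (trn t i) = 1 \<and> \<not> support_vector v t i) \<and>
         (\<exists>i. y (trn t i) = -1 \<and> \<not> support_vector v t i)) \<and>
    (\<forall>t. card {i. y (trn t i) = 1 \<and> support_vector v t i} \<ge> 2 \<and>
         card {i. y (trn t i) = -1 \<and> support_vector v t i} \<ge> 2)"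

end

theory Submission
  imports Defs
begin

text \<open>
  Near a feasible point of the cross-validation problem at which no validation point lies on its
  decision boundary, the objective is constant on the feasible set. The complementarity constraints
  make each \<open>\<zeta>\<close>-component an indicator of misclassification: if \<open>0 < \<zeta>\<^sub>p < 1\<close>, then \<open>z\<^sub>p = 0\<close> and the
  margin \<open>y x \<bullet> w\<close> of validation point \<open>p\<close> is \<open>- z\<^sub>p = 0\<close>, so \<open>x\<close> lies on the boundary. Hence \<open>\<zeta>\<^sub>p\<close> is
  \<open>0\<close> or \<open>1\<close> (\<open>zeta_zero_or_one\<close>), and this value cannot change under a small feasible perturbation.

  Multipliers can therefore be written down at once. With \<open>c = 1 / (K m\<^sub>1)\<close>, the gradient of the
  objective is \<open>c\<close> times the sum of the unit vectors of the coordinates \<open>\<zeta>\<^sub>p\<close>. Of the two constraints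
  that involve \<open>\<zeta>\<^sub>p\<close> alone, exactly one is active: \<open>\<zeta>\<^sub>p \<ge> 0\<close> (an \<open>H\<close>-component) when \<open>\<zeta>\<^sub>p = 0\<close>, and
  \<open>1 - \<zeta>\<^sub>p \<ge> 0\<close> (a \<open>G\<close>-component) when \<open>\<zeta>\<^sub>p = 1\<close>. Giving the first the multiplier \<open>c (1 - \<zeta>\<^sub>p)\<close>, the second
  the multiplier \<open>- c \<zeta>\<^sub>p\<close>, and every other constraint the multiplier \<open>0\<close> balances the gradient. Each
  multiplier vanishes on the index set where C-stationarity demands it, because \<open>\<zeta>\<^sub>p\<close> is \<open>0\<close> or \<open>1\<close>.
  The two kinds of multipliers belong to different complementarity pairs, so in every pair the
  product of the \<open>G\<close>- and the \<open>H\<close>-multiplier is \<open>0\<close>. This gives \<open>feasible_imp_C_stationary\<close>, which is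
  applied to the limit point.
\<close>

lemma grad_affine:
  assumes "\<And>u. F u = k + u \<bullet> D"
  shows "grad F v = D"
proof (rule grad_eqI)
  have "F = (\<lambda>u. k + u \<bullet> D)"
    using assms by (rule ext)
  then show "GDERIV F v :> D"
    unfolding gderiv_def by (auto intro!: derivative_eq_intros)
qed

lemma grad_cv_f:
  fixes v :: "('k::finite, 'a::finite, 'b::finite, 'n::finite) cv_var"
  shows "grad cv_f v =
    (\<Sum>p\<in>UNIV. (1 / (real CARD('k) * real CARD('a))) *\<^sub>R axis (VPair (PZeta p)) 1)"
  by (rule grad_affine[where k = 0])
    (simp add: cv_f_def zeta_of_def inner_vec_def[of 1] inner_sum_right inner_axis sum_distrib_left)

lemma grad_cv_H_zeta: "grad (\<lambda>u. cv_H u $ PZeta p) v = axis (VPair (PZeta p)) 1"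
  by (rule grad_affine[where k = 0]) (simp add: cv_H_def zeta_of_def inner_axis)

lemma grad_cv_G_z: "grad (\<lambda>u. cv_G A B u $ PZ p) v = - axis (VPair (PZeta p)) 1"
  by (rule grad_affine[where k = 1]) (simp add: cv_G_def zeta_of_def inner_axis)

lemma block_mult_block_diag: "block t (block_diag M *v u) = M t *v block t u"
proof -
  have "(\<Sum>c\<in>UNIV. (if t = fst c then M t $ i $ snd c else 0) * u $ c)
      = (\<Sum>j\<in>UNIV. M t $ i $ j * u $ (t, j))" for i
  proof -
    have "(\<Sum>c\<in>UNIV. (if t = fst c then M t $ i $ snd c else 0) * u $ c)
        = (\<Sum>c\<in>Pair t ` UNIV. (if t = fst c then M t $ i $ snd c else 0) * u $ c)"
      by (rule sum.mono_neutral_right) auto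
    also have "\<dots> = (\<Sum>j\<in>UNIV. M t $ i $ j * u $ (t, j))"
      by (subst sum.reindex) (auto simp: inj_on_def)
    finally show ?thesis .
  qed
  then show ?thesis
    by (simp add: vec_eq_iff block_def block_diag_def matrix_vector_mult_def cong: if_cong)
qed

lemma transpose_block_diag: "transpose (block_diag M) = block_diag (\<lambda>t. transpose (M t))"
  by (auto simp: vec_eq_iff transpose_def block_diag_def)

lemma cv_G_zeta_eq_margin:
  assumes A: "A = block_diag (label_matrix x y val)"
    and B: "B = block_diag (label_matrix x y trn)"
  shows "cv_G A B v $ PZeta (t, i) =
    y (val t i) * (x (val t i) \<bullet> cv_w x y trn v t) + z_of v $ (t, i)"
proof -
  let ?u = "transpose B *v alpha_of v + beta_of v - gamma_of v"
  have block_add: "block t (a + b) = block t a + block t b"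
    and block_diff: "block t (a - b) = block t a - block t b"
    for a b :: "real^('l::finite \<times> 'm::finite)" and t :: 'l
    by (simp_all add: block_def vec_eq_iff)
  have w: "block t ?u = cv_w x y trn v t"
    by (simp add: block_add block_diff cv_w_def B transpose_block_diag block_mult_block_diag)
  have "cv_G A B v $ PZeta (t, i) = (A *v ?u) $ (t, i) + z_of v $ (t, i)"
    by (simp add: cv_G_def matrix_vector_mul_assoc[symmetric] matrix_vector_right_distrib
        matrix_vector_mult_diff_distrib)
  also have "(A *v ?u) $ (t, i) = block t (A *v ?u) $ i"
    by (simp add: block_def)
  also have "\<dots> = (label_matrix x y val t *v cv_w x y trn v t) $ i"
    by (simp only: A block_mult_block_diag w)
  also have "\<dots> = y (val t i) * (x (val t i) \<bullet> cv_w x y trn v t)"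
    by (simp add: matrix_vector_mul_component label_matrix_def)
  finally show ?thesis .
qed

lemma mpcc_feasible_complementary:
  assumes "mpcc_feasible g G H v"
  shows "0 \<le> G v $ i" and "0 \<le> H v $ i" and "G v $ i * H v $ i = 0"
proof -
  have GH: "\<And>i. 0 \<le> G v $ i" "\<And>i. 0 \<le> H v $ i" "H v \<bullet> G v = 0"
    using assms by (auto simp: mpcc_feasible_def less_eq_vec_def orthogonal_def)
  then show "0 \<le> G v $ i" "0 \<le> H v $ i"
    by auto
  have "(\<Sum>i\<in>UNIV. H v $ i * G v $ i) = 0"
    using GH(3) by (simp add: inner_vec_def)
  then have "H v $ i * G v $ i = 0"
    using GH(1,2) by (subst (asm) sum_nonneg_eq_0_iff) auto
  then show "G v $ i * H v $ i = 0"
    by (simp add: mult.commute)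
qed

text \<open>Strictly between \<open>0\<close> and \<open>1\<close>, both pairs that involve \<open>\<zeta>\<^sub>p\<close> have a positive member: the pair of
  \<open>1 - \<zeta>\<^sub>p\<close> and \<open>z\<^sub>p\<close> gives \<open>z\<^sub>p = 0\<close>, and then the pair of margin plus \<open>z\<^sub>p\<close> and \<open>\<zeta>\<^sub>p\<close> gives margin \<open>0\<close>.\<close>

lemma zeta_zero_or_one:
  assumes data: "cv_data x y val trn"
    and A: "A = block_diag (label_matrix x y val)"
    and B: "B = block_diag (label_matrix x y trn)"
    and feasible: "mpcc_feasible g (cv_G A B) cv_H v"
    and off_boundary: "\<And>t i. x (val t i) \<bullet> cv_w x y trn v t \<noteq> 0"
  shows "zeta_of v $ p = 0 \<or> zeta_of v $ p = 1"
proof (rule ccontr)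
  assume neither: "\<not> ?thesis"
  obtain t i where p: "p = (t, i)"
    by (cases p)
  have "cv_G A B v $ PZ p * cv_H v $ PZ p = 0" "cv_G A B v $ PZeta p * cv_H v $ PZeta p = 0"
    using mpcc_feasible_complementary(3)[OF feasible] by auto
  then have "z_of v $ p = 0" "cv_G A B v $ PZeta p = 0"
    using neither by (auto simp: cv_G_def cv_H_def)
  then have "y (val t i) * (x (val t i) \<bullet> cv_w x y trn v t) = 0"
    using cv_G_zeta_eq_margin[OF A B, of v t i] by (simp add: p)
  moreover have "y (val t i) \<noteq> 0"
    using data unfolding cv_data_def
    by (metis insert_iff singletonD zero_neq_neg_one zero_neq_one)
  ultimately show False
    using off_boundary by simp
qed

lemma sum_single_constructor:
  fixes F :: "('k::finite, 'a::finite, 'b::finite, 'n::finite) pair_idx \<Rightarrow> 'v::comm_monoid_add"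
  assumes "inj P" "\<And>i. i \<notin> range P \<Longrightarrow> F i = 0"
  shows "(\<Sum>i\<in>UNIV. F i) = (\<Sum>p\<in>UNIV. F (P p))"
proof -
  have "(\<Sum>i\<in>UNIV. F i) = (\<Sum>i\<in>range P. F i)"
    by (rule sum.mono_neutral_right) (use assms(2) in auto)
  also have "\<dots> = (\<Sum>p\<in>UNIV. F (P p))"
    using assms(1) by (simp add: sum.reindex)
  finally show ?thesis .
qed

theorem feasible_imp_C_stationary:
  fixes v :: "('k::finite, 'a::finite, 'b::finite, 'n::finite) cv_var"
  assumes data: "cv_data x y val trn"
    and A: "A = block_diag (label_matrix x y val)"
    and B: "B = block_diag (label_matrix x y trn)"
    and feasible: "mpcc_feasible g (cv_G A B) cv_H v"
    and off_boundary: "\<And>t i. x (val t i) \<bullet> cv_w x y trn v t \<noteq> 0"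
  shows "C_stationary cv_f g (cv_G A B) cv_H v"
proof -
  define c where "c = 1 / (real CARD('k) * real CARD('a))"
  \<comment> \<open>The constraint \<open>1 - \<zeta>\<^sub>p \<ge> 0\<close> is the \<open>G\<close>-component of the pair named after \<open>z\<^sub>p\<close>, hence the
    index \<open>PZ p\<close>. Since \<open>\<zeta>\<^sub>p \<in> {0, 1}\<close>, each multiplier is nonzero only where its constraint is
    active.\<close>
  define \<gamma> :: "real^('k, 'a, 'b, 'n) pair_idx"
    where "\<gamma> = (\<chi> i. case i of PZ p \<Rightarrow> - c * zeta_of v $ p | _ \<Rightarrow> 0)"
  define \<nu> :: "real^('k, 'a, 'b, 'n) pair_idx"
    where "\<nu> = (\<chi> i. case i of PZeta p \<Rightarrow> c * (1 - zeta_of v $ p) | _ \<Rightarrow> 0)"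
  let ?e = "\<lambda>p. axis (VPair (PZeta p)) 1 :: ('k, 'a, 'b, 'n) cv_var"
  note zeta01 = zeta_zero_or_one[OF data A B feasible off_boundary]
  have sum_G: "(\<Sum>i\<in>UNIV. \<gamma> $ i *\<^sub>R grad (\<lambda>u. cv_G A B u $ i) v)
      = (\<Sum>p\<in>UNIV. (c * zeta_of v $ p) *\<^sub>R ?e p)"
    by (subst sum_single_constructor[where P = PZ])
      (auto simp: \<gamma>_def grad_cv_G_z inj_def split: pair_idx.split)
  have sum_H: "(\<Sum>i\<in>UNIV. \<nu> $ i *\<^sub>R grad (\<lambda>u. cv_H u $ i) v)
      = (\<Sum>p\<in>UNIV. (c * (1 - zeta_of v $ p)) *\<^sub>R ?e p)"
    by (subst sum_single_constructor[where P = PZeta])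
      (auto simp: \<nu>_def grad_cv_H_zeta inj_def split: pair_idx.split)
  have f: "grad cv_f v = (\<Sum>p\<in>UNIV. c *\<^sub>R ?e p)"
    by (simp add: grad_cv_f c_def)
  have balance: "grad cv_f v
      - (\<Sum>i\<in>UNIV. \<gamma> $ i *\<^sub>R grad (\<lambda>u. cv_G A B u $ i) v)
      - (\<Sum>i\<in>UNIV. \<nu> $ i *\<^sub>R grad (\<lambda>u. cv_H u $ i) v) = 0"
    unfolding f sum_G sum_H sum_subtractf[symmetric] scaleR_diff_left[symmetric]
    by (simp add: algebra_simps)
  have \<gamma>_I_H: "\<forall>i\<in>I_H (cv_G A B) cv_H v. \<gamma> $ i = 0"
    using zeta01 by (force simp: I_H_def \<gamma>_def cv_G_def split: pair_idx.split)
  have \<nu>_I_G: "\<forall>i\<in>I_G (cv_G A B) cv_H v. \<nu> $ i = 0"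
    using zeta01 by (force simp: I_G_def \<nu>_def cv_H_def split: pair_idx.split)
  have "\<forall>i\<in>I_GH (cv_G A B) cv_H v. \<gamma> $ i * \<nu> $ i \<ge> 0"
    by (auto simp: \<gamma>_def \<nu>_def split: pair_idx.split)
  with balance \<gamma>_I_H \<nu>_I_G feasible show ?thesis
    unfolding C_stationary_def by (intro conjI exI[of _ \<gamma>] exI[of _ \<nu>] exI[of _ 0]) simp_all
qed

theorem theorem3:
  fixes x :: "'d \<Rightarrow> real^'n"
    and y :: "'d \<Rightarrow> real"
    and val :: "'k::finite \<Rightarrow> 'a::finite \<Rightarrow> 'd"
    and trn :: "'k \<Rightarrow> 'b::finite \<Rightarrow> 'd"
    and A :: "real^('k \<times> 'n)^('k \<times> 'a)"
    and B :: "real^('k \<times> 'n)^('k \<times> 'b)"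
    and C_lb C_ub :: real
    and w_lb w_ub :: "real^'n"
    and \<tau> :: "nat \<Rightarrow> real"
    and vs :: "nat \<Rightarrow> ('k, 'a, 'b, 'n) cv_var"
    and v :: "('k, 'a, 'b, 'n) cv_var"
  assumes data: "cv_data x y val trn"
    and A: "A = block_diag (label_matrix x y val)"
    and B: "B = block_diag (label_matrix x y trn)"
    and bounds: "0 \<le> C_lb" "0 \<le> C_ub" "0 \<le> w_lb" "0 \<le> w_ub"
    and tau: "\<And>k. 0 < \<tau> k" "decseq \<tau>" "\<tau> \<longlonglongrightarrow> 0"
    and stationary: "\<And>k. relaxed_stationary cv_f (cv_g C_lb C_ub w_lb w_ub) (cv_G A B) cv_H (\<tau> k) (vs k)"
    and lim: "vs \<longlonglongrightarrow> v"
    and feasible: "mpcc_feasible (cv_g C_lb C_ub w_lb w_ub) (cv_G A B) cv_H v"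
    and standing: "standing_assumptions x y val trn v"
  shows "C_stationary cv_f (cv_g C_lb C_ub w_lb w_ub) (cv_G A B) cv_H v"
proof (rule feasible_imp_C_stationary[OF data A B feasible])
  show "x (val t i) \<bullet> cv_w x y trn v t \<noteq> 0" for t i
    using standing by (simp add: standing_assumptions_def)
qed

end
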